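(* Let $G_1$ and $G_2$ be finite groups with subgroups $H_1 \le G_1$ and $H_2 \le G_2$, and let $(\alpha, \beta)$ be an isoclinism from the pair $(G_1, H_1)$ to the pair $(G_2, H_2)$. If $g \in [H_1, G_1]$ then ${\Pr}_g(H_1, G_1) = {\Pr}_{\beta(g)}(H_2, G_2)$.
   Context: For a finite group $X$ and a subgroup $Y$ of $X$: $[x,y] := xyx^{-1}y^{-1}$; $[Y,X]$ is the subgroup generated by all $[y,x]$ with $y\in Y$, $x \in X$; $Z(Y,X) := \{y \in Y : yx = xy \text{ for all } x \in X\} = Z(X)\cap Y$. Put $\bar Y = Y/Z(Y,X)$ and $\bar X = X/Z(Y,X)$. The map $a_{(Y,X)} : \bar Y\times\bar X \to [Y,X]$, $a_{(Y,X)}(yZ(Y,X), xZ(Y,X)) = [y,x]$, is well defined. Let $G_1, G_2$ be finite groups with subgroups $H_1, H_2$ respectively; write $\bar G_i = G_i/Z(H_i,G_i)$ and $\bar H_i = H_i/Z(H_i,G_i)$. An isoclinism from the pair $(G_1,H_1)$ to the pair $(G_2,H_2)$ is a pair $(\alpha,\beta)$ where $\alpha : \bar G_1 \to \bar G_2$ is a group isomorphism with $\alpha(\bar H_1) = \bar H_2$, and $\beta : [H_1,G_1]\to[H_2,G_2]$ is a group isomorphism, such that $\beta\big(a_{(H_1,G_1)}(u,v)\big) = a_{(H_2,G_2)}(\alpha(u),\alpha(v))$ for all $u \in \bar H_1$, $v\in \bar G_1$. For a subgroup $H$ of a finite group $G$ and $g \in G$, \[ {\Pr}_g(H,G) :=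 \frac{|\{(x,y)\in H\times G : xyx^{-1}y^{-1} = g\}|}{|H||G|}. \] *)

theory Defs
  imports Complex_Main "HOL-Algebra.Coset" "HOL-Algebra.Generated_Groups"
begin

definition commutator :: "('a, 'm) monoid_scheme \<Rightarrow> 'a \<Rightarrow> 'a \<Rightarrow> 'a" where
  "commutator G x y = x \<otimes>\<^bsub>G\<^esub> y \<otimes>\<^bsub>G\<^esub> inv\<^bsub>G\<^esub> x \<otimes>\<^bsub>G\<^esub> inv\<^bsub>G\<^esub> y"

definition commutator_subgroup :: "('a, 'm) monoid_scheme \<Rightarrow> 'a set \<Rightarrow> 'a set" where
  "commutator_subgroup G H = generate G {commutator G y x | y x. y \<in> H \<and> x \<in> carrier G}"

definition rel_center :: "('a, 'm) monoid_scheme \<Rightarrow> 'a set \<Rightarrow> 'a set" where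
  "rel_center G H = {y \<in> H. \<forall>x \<in> carrier G. y \<otimes>\<^bsub>G\<^esub> x = x \<otimes>\<^bsub>G\<^esub> y}"

abbreviation bar_group :: "('a, 'm) monoid_scheme \<Rightarrow> 'a set \<Rightarrow> 'a set monoid" where
  "bar_group G H \<equiv> G Mod (rel_center G H)"

text \<open>The carrier of \<open>H / Z(H,G)\<close>, as a subset of that of \<open>G / Z(H,G)\<close>.\<close>

definition bar_subgroup :: "('a, 'm) monoid_scheme \<Rightarrow> 'a set \<Rightarrow> 'a set set" where
  "bar_subgroup G H = (\<lambda>y. rel_center G H #>\<^bsub>G\<^esub> y) ` H"

text \<open>The map \<open>a_(H,G)\<close> on cosets; it is specified by its values on representatives, and
  \<open>commutator_map_coset\<close> below shows that these do not depend on the choice.\<close>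

definition commutator_map ::
  "('a, 'm) monoid_scheme \<Rightarrow> 'a set \<Rightarrow> 'a set \<Rightarrow> 'a set \<Rightarrow> 'a" where
  "commutator_map G H u v =
     (THE c. \<exists>y \<in> H. \<exists>x \<in> carrier G.
        u = rel_center G H #>\<^bsub>G\<^esub> y \<and> v = rel_center G H #>\<^bsub>G\<^esub> x \<and> c = commutator G y x)"

definition isoclinism ::
  "('a, 'm) monoid_scheme \<Rightarrow> 'a set \<Rightarrow> ('b, 'n) monoid_scheme \<Rightarrow> 'b set \<Rightarrow>
   ('a set \<Rightarrow> 'b set) \<Rightarrow> ('a \<Rightarrow> 'b) \<Rightarrow> bool" where
  "isoclinism G1 H1 G2 H2 \<alpha> \<beta> \<longleftrightarrow>
     \<alpha> \<in> iso (bar_group G1 H1) (bar_group G2 H2) \<and>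
     \<alpha> ` bar_subgroup G1 H1 = bar_subgroup G2 H2 \<and>
     \<beta> \<in> iso (G1\<lparr>carrier := commutator_subgroup G1 H1\<rparr>)
             (G2\<lparr>carrier := commutator_subgroup G2 H2\<rparr>) \<and>
     (\<forall>u \<in> bar_subgroup G1 H1. \<forall>v \<in> carrier (bar_group G1 H1).
        \<beta> (commutator_map G1 H1 u v) = commutator_map G2 H2 (\<alpha> u) (\<alpha> v))"

definition commutator_prob :: "('a, 'm) monoid_scheme \<Rightarrow> 'a set \<Rightarrow> 'a \<Rightarrow> real" where
  "commutator_prob G H g =
     real (card {(x, y) \<in> H \<times> carrier G. commutator G x y = g}) / (real (card H) * real (order G))"

lemma rel_center_comm:
  "z \<in> rel_center G H \<Longrightarrow> w \<in> carrier G \<Longrightarrow> z \<otimes>\<^bsub>G\<^esub> w = w \<otimes>\<^bsub>G\<^esub> z"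
  unfolding rel_center_def by blast

lemma rel_centerI:
  "z \<in> H \<Longrightarrow> (\<And>w. w \<in> carrier G \<Longrightarrow> z \<otimes>\<^bsub>G\<^esub> w = w \<otimes>\<^bsub>G\<^esub> z) \<Longrightarrow> z \<in> rel_center G H"
  unfolding rel_center_def by blast

lemma rel_center_subset: "rel_center G H \<subseteq> H"
  unfolding rel_center_def by blast

lemma (in group) inv_cancel_left:
  assumes "x \<in> carrier G" "w \<in> carrier G"
  shows "inv x \<otimes> (x \<otimes> w) = w"
  using m_assoc[OF inv_closed[OF assms(1)] assms, symmetric] assms by (simp only: l_inv l_one)

lemma (in group) rel_center_subgroup:
  assumes H: "subgroup H G"
  shows "subgroup (rel_center G H) G"
proof
  show sub: "rel_center G H \<subseteq> carrier G"
    using subgroup.subset[OF H] rel_center_subset[of G H] by blast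
  show "\<one> \<in> rel_center G H"
    by (rule rel_centerI) (simp_all add: subgroup.one_closed[OF H])
  fix x assume x: "x \<in> rel_center G H"
  then have xc: "x \<in> carrier G" and xH: "x \<in> H" using sub rel_center_subset[of G H] by blast+
  { fix y assume y: "y \<in> rel_center G H"
    then have yc: "y \<in> carrier G" and yH: "y \<in> H" using sub rel_center_subset[of G H] by blast+
    show "x \<otimes> y \<in> rel_center G H"
    proof (rule rel_centerI)
      show "x \<otimes> y \<in> H" using xH yH by (rule subgroup.m_closed[OF H])
      fix w assume w: "w \<in> carrier G"
      have "x \<otimes> y \<otimes> w = x \<otimes> (y \<otimes> w)" by (rule m_assoc[OF xc yc w])
      also have "\<dots> = x \<otimes> (w \<otimes> y)" by (simp only: rel_center_comm[OF y w])
      also have "\<dots> = x \<otimes> w \<otimes> y" by (rule m_assoc[OF xc w yc, symmetric])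
      also have "\<dots> = w \<otimes> x \<otimes> y" by (simp only: rel_center_comm[OF x w])
      also have "\<dots> = w \<otimes> (x \<otimes> y)" by (rule m_assoc[OF w xc yc])
      finally show "x \<otimes> y \<otimes> w = w \<otimes> (x \<otimes> y)" .
    qed }
  show "inv x \<in> rel_center G H"
  proof (rule rel_centerI)
    show "inv x \<in> H" using xH by (rule subgroup.m_inv_closed[OF H])
    fix w assume w: "w \<in> carrier G"
    have "inv x \<otimes> w = inv x \<otimes> (w \<otimes> (x \<otimes> inv x))"
      using xc w by (simp only: r_inv r_one)
    also have "\<dots> = inv x \<otimes> (w \<otimes> x) \<otimes> inv x"
      using xc w by (simp only: m_assoc m_closed inv_closed)
    also have "\<dots> = inv x \<otimes> (x \<otimes> w) \<otimes> inv x" by (simp only: rel_center_comm[OF x w])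
    also have "\<dots> = w \<otimes> inv x" by (simp only: inv_cancel_left[OF xc w])
    finally show "inv x \<otimes> w = w \<otimes> inv x" .
  qed
qed

lemma (in group) rel_center_normal:
  assumes "subgroup H G"
  shows "rel_center G H \<lhd> G"
proof (rule normalI[OF rel_center_subgroup[OF assms]], rule ballI)
  fix x assume "x \<in> carrier G"
  then show "rel_center G H #> x = x <# rel_center G H"
    unfolding r_coset_def l_coset_def by (intro SUP_cong refl) (metis rel_center_comm)
qed

lemma (in group) commutator_subgroup_is_subgroup:
  assumes "subgroup H G"
  shows "subgroup (commutator_subgroup G H) G"
  unfolding commutator_subgroup_def
  by (rule generate_is_subgroup)
    (use subgroup.subset[OF assms] in \<open>auto simp: commutator_def\<close>)

lemma (in group) commutator_cong_rel_center:
  assumes H: "subgroup H G" and z: "z \<in> rel_center G H"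
    and y: "y \<in> carrier G" and x: "x \<in> carrier G"
  shows "commutator G (z \<otimes> y) x = commutator G y x"
    and "commutator G y (z \<otimes> x) = commutator G y x"
proof -
  have iz: "inv z \<in> rel_center G H"
    using rel_center_subgroup[OF H] z by (rule subgroup.m_inv_closed)
  have zc: "z \<in> carrier G" using subgroup.subset[OF rel_center_subgroup[OF H]] z by blast
  have comm: "w \<otimes> inv z = inv z \<otimes> w" if "w \<in> carrier G" for w
    using rel_center_comm[OF iz that] by simp
  have "commutator G (z \<otimes> y) x = z \<otimes> (y \<otimes> x \<otimes> inv y) \<otimes> inv z \<otimes> inv x"
    using x y zc by (simp add: commutator_def inv_mult_group m_assoc)
  also have "\<dots> = inv z \<otimes> (z \<otimes> (y \<otimes> x \<otimes> inv y)) \<otimes> inv x"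
    using comm[of "z \<otimes> (y \<otimes> x \<otimes> inv y)"] x y zc by simp
  also have "\<dots> = commutator G y x"
    using x y zc by (simp add: commutator_def m_assoc inv_cancel_left)
  finally show "commutator G (z \<otimes> y) x = commutator G y x" .
  have yz: "y \<otimes> z = z \<otimes> y" using rel_center_comm[OF z y] by simp
  have "commutator G y (z \<otimes> x) = (y \<otimes> z) \<otimes> x \<otimes> inv y \<otimes> (inv x \<otimes> inv z)"
    using x y zc by (simp add: commutator_def inv_mult_group m_assoc)
  also have "\<dots> = z \<otimes> commutator G y x \<otimes> inv z"
    unfolding yz using x y zc by (simp add: commutator_def m_assoc)
  also have "\<dots> = inv z \<otimes> (z \<otimes> commutator G y x)"
    using comm[of "z \<otimes> commutator G y x"] x y zc by (simp add: commutator_def)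
  also have "\<dots> = commutator G y x"
    using x y zc by (simp add: commutator_def m_assoc inv_cancel_left)
  finally show "commutator G y (z \<otimes> x) = commutator G y x" .
qed

lemma (in group) commutator_map_coset:
  assumes H: "subgroup H G" and y: "y \<in> H" and x: "x \<in> carrier G"
  shows "commutator_map G H (rel_center G H #> y) (rel_center G H #> x) = commutator G y x"
  unfolding commutator_map_def
proof (rule the_equality)
  show "\<exists>y'\<in>H. \<exists>x'\<in>carrier G. rel_center G H #> y = rel_center G H #> y' \<and>
      rel_center G H #> x = rel_center G H #> x' \<and> commutator G y x = commutator G y' x'"
    using y x by blast
next
  fix c
  assume "\<exists>y'\<in>H. \<exists>x'\<in>carrier G. rel_center G H #> y = rel_center G H #> y' \<and>
      rel_center G H #> x = rel_center G H #> x' \<and> c = commutator G y' x'"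
  then obtain y' x' where *: "y' \<in> H" "x' \<in> carrier G"
    "rel_center G H #> y = rel_center G H #> y'" "rel_center G H #> x = rel_center G H #> x'"
    "c = commutator G y' x'" by blast
  have yc: "y \<in> carrier G" "y' \<in> carrier G" using subgroup.subset[OF H] y * by auto
  have "y' \<in> rel_center G H #> y" "x' \<in> rel_center G H #> x"
    using * yc rcos_self rel_center_subgroup[OF H] by auto
  then obtain z w where zw: "z \<in> rel_center G H" "y' = z \<otimes> y" "w \<in> rel_center G H" "x' = w \<otimes> x"
    by (auto simp: r_coset_def)
  have "z \<otimes> y \<in> carrier G" using yc zw(2) by simp
  then show "c = commutator G y x"
    using *(5) commutator_cong_rel_center(1)[OF H zw(1) yc(1) x]
      commutator_cong_rel_center(2)[OF H zw(3) _ x] zw(2,4) by simp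
qed

end

theory Submission
  imports Defs
begin

text \<open>
  Both sides of the equation can be read off from the quotients by the relative centre \<open>Z\<close>.
  A commutator \<open>[y, x]\<close> depends only on the cosets of \<open>y\<close> and \<open>x\<close> modulo \<open>Z\<close>, so the set of
  solutions of \<open>[y, x] = g\<close> is a disjoint union of products of two cosets, each having
  \<open>|Z|\<^sup>2\<close> elements; the same is true of \<open>H \<times> G\<close> itself. Hence the factors \<open>|Z|\<^sup>2\<close> cancel and
  the probability is the proportion of pairs \<open>(u, v)\<close> of cosets that the commutator map sends
  to \<open>g\<close> (\<open>commutator_prob_cosets\<close>).

  An isoclinism preserves this proportion: \<open>\<alpha> \<times> \<alpha>\<close> is a bijection between the pairs of cosets
  on the two sides, and since \<open>\<beta>\<close> is injective on the commutator subgroup, it carries the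
  solutions for \<open>g\<close> exactly onto the solutions for \<open>\<beta> g\<close>
  (\<open>isoclinism_bij_coset_solutions\<close>).
\<close>

text \<open>Distinct cosets are disjoint and all have the size of the subgroup, so passing from pairs of
  cosets to pairs of representatives multiplies cardinalities by a constant. The statement covers
  arbitrary families \<open>T\<close> because it is needed both for the solutions of a commutator equation
  and for the set of all pairs.\<close>

lemma (in group) card_Union_coset_products:
  assumes N: "subgroup N G" and fin: "finite (carrier G)"
    and T: "T \<subseteq> (rcosets N) \<times> (rcosets N)"
  shows "card (\<Union>(u, v)\<in>T. u \<times> v) = card T * (card N)\<^sup>2"
proof -
  have sub: "N \<subseteq> carrier G" by (rule subgroup.subset[OF N])
  have finR: "finite (rcosets N)"
    using rcosets_subset_PowG[OF N] fin by (rule finite_subset[OF _ finite_Pow_iff[THEN iffD2]])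
  have finT: "finite T" using finite_subset[OF T] finR by blast
  have fin_coset: "finite u" if "u \<in> rcosets N" for u
    using cosets_finite[OF that sub fin] .
  have card_coset: "card u = card N" if "u \<in> rcosets N" for u
    using card_rcosets_equal[OF that sub] by simp
  have disj: "u \<inter> u' = {}" if "u \<in> rcosets N" "u' \<in> rcosets N" "u \<noteq> u'" for u u'
    using rcos_disjoint[OF N] that by (auto simp: pairwise_def disjnt_def)
  have "card (\<Union>p\<in>T. fst p \<times> snd p) = (\<Sum>p\<in>T. card (fst p \<times> snd p))"
  proof (rule card_UN_disjoint[OF finT])
    show "\<forall>p\<in>T. finite (fst p \<times> snd p)" using T fin_coset by auto
    show "\<forall>p\<in>T. \<forall>q\<in>T. p \<noteq> q \<longrightarrow> (fst p \<times> snd p) \<inter> (fst q \<times> snd q) = {}"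
    proof (intro ballI impI)
      fix p q assume pq: "p \<in> T" "q \<in> T" "p \<noteq> q"
      then have "fst p \<noteq> fst q \<or> snd p \<noteq> snd q" by (simp add: prod_eq_iff)
      moreover have "fst p \<in> rcosets N" "fst q \<in> rcosets N" "snd p \<in> rcosets N" "snd q \<in> rcosets N"
        using pq T by auto
      ultimately show "(fst p \<times> snd p) \<inter> (fst q \<times> snd q) = {}"
        using disj by (fastforce simp: Times_Int_Times)
    qed
  qed
  also have "\<dots> = (\<Sum>p\<in>T. (card N)\<^sup>2)"
    using T by (intro sum.cong) (auto simp: card_cartesian_product card_coset power2_eq_square)
  finally show ?thesis by (simp add: case_prod_beta)
qed

lemma carrier_bar_group: "carrier (bar_group G H) = rcosets\<^bsub>G\<^esub> (rel_center G H)"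
  by (simp add: FactGroup_def)

lemma (in group) bar_subgroup_subset:
  assumes "subgroup H G"
  shows "bar_subgroup G H \<subseteq> rcosets (rel_center G H)"
  using subgroup.subset[OF assms] by (auto simp: bar_subgroup_def RCOSETS_def)

lemma (in group) mem_subgroup_of_bar_subgroup:
  assumes "subgroup H G" and "u \<in> bar_subgroup G H" and "y \<in> u"
  shows "y \<in> H"
  using assms rel_center_subset[of G H] subgroup.m_closed[OF assms(1)]
  by (auto simp: bar_subgroup_def r_coset_def)

lemma (in group) rel_center_coset_eq:
  assumes "subgroup H G" and "u \<in> rcosets (rel_center G H)" and "y \<in> u"
  shows "y \<in> carrier G" and "u = rel_center G H #> y"
proof -
  have Z: "subgroup (rel_center G H) G" by (rule rel_center_subgroup[OF assms(1)])
  show "y \<in> carrier G" using rcosets_part_G[OF Z] assms(2,3) by blast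
  obtain x where x: "x \<in> carrier G" "u = rel_center G H #> x"
    using assms(2) by (auto simp: RCOSETS_def)
  then show "u = rel_center G H #> y"
    using repr_independence[OF _ x(1) Z] assms(3) by simp
qed

lemma (in group) commutator_map_in_commutator_subgroup:
  assumes H: "subgroup H G"
    and u: "u \<in> bar_subgroup G H" and v: "v \<in> carrier (bar_group G H)"
  shows "commutator_map G H u v \<in> commutator_subgroup G H"
proof -
  obtain y where y: "y \<in> H" "u = rel_center G H #> y" using u by (auto simp: bar_subgroup_def)
  obtain x where x: "x \<in> carrier G" "v = rel_center G H #> x"
    using v by (auto simp: carrier_bar_group RCOSETS_def)
  have "commutator_map G H u v = commutator G y x"
    using commutator_map_coset[OF H y(1) x(1)] y x by simp
  then show ?thesis
    using y x unfolding commutator_subgroup_def by (auto intro: generate.incl)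
qed

definition coset_solutions :: "('a, 'm) monoid_scheme \<Rightarrow> 'a set \<Rightarrow> 'a \<Rightarrow> ('a set \<times> 'a set) set" where
  "coset_solutions G H g =
     {(u, v) \<in> bar_subgroup G H \<times> carrier (bar_group G H). commutator_map G H u v = g}"

text \<open>The numerator and the denominator of the probability are both blown up by \<open>|Z|\<^sup>2\<close> from
  their counterparts for cosets.\<close>

lemma (in group) commutator_prob_cosets:
  assumes H: "subgroup H G" and fin: "finite (carrier G)"
  shows "commutator_prob G H g = real (card (coset_solutions G H g)) /
    (real (card (bar_subgroup G H)) * real (order (bar_group G H)))"
proof -
  let ?Z = "rel_center G H"
  let ?B = "bar_subgroup G H \<times> carrier (bar_group G H)"
  have Z: "subgroup ?Z G" by (rule rel_center_subgroup[OF H])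
  have B: "?B \<subseteq> (rcosets ?Z) \<times> (rcosets ?Z)"
    using bar_subgroup_subset[OF H] by (auto simp: carrier_bar_group)
  \<comment> \<open>Every member of a coset represents it, so the union is over the pairs of representatives.\<close>
  have union: "(\<Union>(u, v)\<in>{(u, v) \<in> ?B. P u v}. u \<times> v) =
      {(y, x) \<in> H \<times> carrier G. P (?Z #> y) (?Z #> x)}" (is "?L = ?R") for P
  proof (intro subset_antisym subsetI)
    fix p assume "p \<in> ?L"
    then obtain u v y x where *: "p = (y, x)" "u \<in> bar_subgroup G H"
      "v \<in> carrier (bar_group G H)" "P u v" "y \<in> u" "x \<in> v" by auto
    have uv: "u \<in> rcosets ?Z" "v \<in> rcosets ?Z"
      using * bar_subgroup_subset[OF H] by (auto simp: carrier_bar_group)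
    have "y \<in> H" by (rule mem_subgroup_of_bar_subgroup[OF H *(2,5)])
    moreover have "x \<in> carrier G" by (rule rel_center_coset_eq(1)[OF H uv(2) *(6)])
    moreover have "P (?Z #> y) (?Z #> x)"
      using *(4) by (simp only: rel_center_coset_eq(2)[OF H uv(1) *(5), symmetric]
        rel_center_coset_eq(2)[OF H uv(2) *(6), symmetric])
    ultimately show "p \<in> ?R" using *(1) by blast
  next
    fix p assume "p \<in> ?R"
    then obtain y x where *: "p = (y, x)" "y \<in> H" "x \<in> carrier G" "P (?Z #> y) (?Z #> x)"
      by blast
    have "?Z #> y \<in> bar_subgroup G H" using *(2) by (simp add: bar_subgroup_def)
    moreover have "?Z #> x \<in> carrier (bar_group G H)"
      using *(3) by (auto simp: carrier_bar_group RCOSETS_def)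
    moreover have "y \<in> ?Z #> y" "x \<in> ?Z #> x"
      using rcos_self[OF _ Z] *(2,3) subgroup.subset[OF H] by blast+
    ultimately show "p \<in> ?L" using *(1,4) by blast
  qed
  have sol: "coset_solutions G H g = {(u, v) \<in> ?B. commutator_map G H u v = g}"
    by (simp add: coset_solutions_def)
  have "{(y, x) \<in> H \<times> carrier G. commutator G y x = g} =
      {(y, x) \<in> H \<times> carrier G. commutator_map G H (?Z #> y) (?Z #> x) = g}"
    by (intro Collect_cong) (use commutator_map_coset[OF H] in auto)
  also have "\<dots> = (\<Union>(u, v)\<in>coset_solutions G H g. u \<times> v)"
    unfolding sol by (rule union[symmetric])
  also have "card \<dots> = card (coset_solutions G H g) * (card ?Z)\<^sup>2"
    by (rule card_Union_coset_products[OF Z fin]) (use B in \<open>auto simp: coset_solutions_def\<close>)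
  finally have num: "card {(y, x) \<in> H \<times> carrier G. commutator G y x = g} =
      card (coset_solutions G H g) * (card ?Z)\<^sup>2" .
  have den: "card H * order G =
      card (bar_subgroup G H) * order (bar_group G H) * (card ?Z)\<^sup>2"
    using card_Union_coset_products[OF Z fin B] union[of "\<lambda>_ _. True"]
    by (simp add: card_cartesian_product order_def)
  have "card ?Z \<noteq> 0"
    using Z fin subgroup.one_closed[OF Z] finite_subset[OF subgroup.subset[OF Z]] by auto
  then show ?thesis
    unfolding commutator_prob_def num of_nat_mult[symmetric] den by simp
qed

text \<open>Compatibility of \<open>\<alpha>\<close> and \<open>\<beta>\<close> with the commutator maps gives \<open>\<beta> (a(u, v)) = a(\<alpha> u, \<alpha> v)\<close>.
  Injectivity of \<open>\<beta>\<close> on the commutator subgroup, which contains both \<open>a(u, v)\<close> and \<open>g\<close>, is what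
  makes \<open>a(u, v) = g\<close> equivalent to \<open>a(\<alpha> u, \<alpha> v) = \<beta> g\<close>.\<close>

lemma isoclinism_bij_coset_solutions:
  assumes "group G1" and H1: "subgroup H1 G1"
    and iso: "isoclinism G1 H1 G2 H2 \<alpha> \<beta>"
    and g: "g \<in> commutator_subgroup G1 H1"
  shows "bij_betw (map_prod \<alpha> \<alpha>) (coset_solutions G1 H1 g) (coset_solutions G2 H2 (\<beta> g))"
proof -
  interpret G1: group G1 by fact
  let ?S = "bar_subgroup G1 H1" and ?C = "carrier (bar_group G1 H1)"
  have bij: "bij_betw \<alpha> ?C (carrier (bar_group G2 H2))"
    and image: "\<alpha> ` ?S = bar_subgroup G2 H2"
    and inj: "inj_on \<beta> (commutator_subgroup G1 H1)"
    and compat: "\<And>u v. u \<in> ?S \<Longrightarrow> v \<in> ?C \<Longrightarrow>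
      \<beta> (commutator_map G1 H1 u v) = commutator_map G2 H2 (\<alpha> u) (\<alpha> v)"
    using iso by (auto simp: isoclinism_def iso_def bij_betw_def)
  have "?S \<subseteq> ?C" using G1.bar_subgroup_subset[OF H1] by (simp add: carrier_bar_group)
  then have "bij_betw \<alpha> ?S (bar_subgroup G2 H2)"
    using bij image by (auto intro: bij_betw_subset)
  then have prod: "bij_betw (map_prod \<alpha> \<alpha>) (?S \<times> ?C)
      (bar_subgroup G2 H2 \<times> carrier (bar_group G2 H2))"
    using bij by (rule bij_betw_map_prod)
  have equiv: "commutator_map G2 H2 (\<alpha> u) (\<alpha> v) = \<beta> g \<longleftrightarrow> commutator_map G1 H1 u v = g"
    if "u \<in> ?S" "v \<in> ?C" for u v
    using that compat inj_on_eq_iff[OF inj _ g]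
      G1.commutator_map_in_commutator_subgroup[OF H1 that] by metis
  have "map_prod \<alpha> \<alpha> ` coset_solutions G1 H1 g = coset_solutions G2 H2 (\<beta> g)"
  proof (intro subset_antisym subsetI)
    fix q assume "q \<in> map_prod \<alpha> \<alpha> ` coset_solutions G1 H1 g"
    then show "q \<in> coset_solutions G2 H2 (\<beta> g)"
      using equiv bij_betwE[OF prod] by (fastforce simp: coset_solutions_def)
  next
    fix q assume q: "q \<in> coset_solutions G2 H2 (\<beta> g)"
    then have "q \<in> map_prod \<alpha> \<alpha> ` (?S \<times> ?C)"
      unfolding bij_betw_imp_surj_on[OF prod] coset_solutions_def by blast
    then obtain p where p: "p \<in> ?S \<times> ?C" "q = map_prod \<alpha> \<alpha> p" by (elim imageE)
    then have "p \<in> coset_solutions G1 H1 g"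
      using q equiv by (auto simp: coset_solutions_def)
    then show "q \<in> map_prod \<alpha> \<alpha> ` coset_solutions G1 H1 g"
      unfolding p(2) by (rule imageI)
  qed
  moreover have "coset_solutions G1 H1 g \<subseteq> ?S \<times> ?C" unfolding coset_solutions_def by blast
  ultimately show ?thesis using bij_betw_subset[OF prod] by blast
qed

theorem theorem2p1:
  fixes G1 :: "('a, 'm) monoid_scheme" and G2 :: "('b, 'n) monoid_scheme"
    and H1 :: "'a set" and H2 :: "'b set"
    and \<alpha> :: "'a set \<Rightarrow> 'b set" and \<beta> :: "'a \<Rightarrow> 'b" and g :: 'a
  assumes "group G1" and "finite (carrier G1)" and "subgroup H1 G1"
    and "group G2" and "finite (carrier G2)" and "subgroup H2 G2"
    and "isoclinism G1 H1 G2 H2 \<alpha> \<beta>"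
    and "g \<in> commutator_subgroup G1 H1"
  shows "commutator_prob G1 H1 g = commutator_prob G2 H2 (\<beta> g)"
proof -
  have bij: "bij_betw \<alpha> (carrier (bar_group G1 H1)) (carrier (bar_group G2 H2))"
    and image: "\<alpha> ` bar_subgroup G1 H1 = bar_subgroup G2 H2"
    using assms(7) by (auto simp: isoclinism_def iso_def)
  have "bar_subgroup G1 H1 \<subseteq> carrier (bar_group G1 H1)"
    using group.bar_subgroup_subset[OF assms(1,3)] by (simp add: carrier_bar_group)
  then have "card (bar_subgroup G1 H1) = card (bar_subgroup G2 H2)"
    using bij image by (metis bij_betw_same_card bij_betw_subset)
  moreover have "order (bar_group G1 H1) = order (bar_group G2 H2)"
    using bij by (simp add: order_def bij_betw_same_card)
  moreover have "card (coset_solutions G1 H1 g) = card (coset_solutions G2 H2 (\<beta> g))"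
    by (rule bij_betw_same_card[OF isoclinism_bij_coset_solutions[OF assms(1,3,7,8)]])
  ultimately show ?thesis
    using group.commutator_prob_cosets[OF assms(1,3,2)]
      group.commutator_prob_cosets[OF assms(4,6,5)] by simp
qed

end
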